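(* Let $P(x)$ be a nonlinear polynomial with real coefficients. If the sequence $(\lfloor P(k)\rfloor)_{k\geq 1}$ is u.d. mod all large enough primes (that is, there is $p_0$ such that it is u.d. mod $p$ for every prime $p\geq p_0$), then $P(x)$ has at least one irrational coefficient other than the constant term.
   Context: A nonlinear polynomial is a polynomial of degree at least $2$. An integer sequence $(a_k)_{k\geq 1}$ is u.d. (uniformly distributed) mod an integer $m\geq 2$ if for every integer $i$, $\lim_{N\to\infty}\frac{1}{N}\#\{k\in\{1,\ldots,N\}: a_k\equiv i \pmod m\}=\frac{1}{m}$. Here $\lfloor r\rfloor$ denotes the greatest integer not exceeding $r$. *)

theory Defs
  imports
    Complex_Main
    "HOL-Computational_Algebra.Computational_Algebra"
    "HOL-Number_Theory.Cong"
begin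

(* Sequences are indexed from k = 1; the value a 0 is irrelevant. *)
definition ud_mod :: "(nat \<Rightarrow> int) \<Rightarrow> int \<Rightarrow> bool" where
  "ud_mod a m \<longleftrightarrow> m \<ge> 2 \<and>
     (\<forall>i::int. (\<lambda>N::nat. real (card {k \<in> {1..N}. [a k = i] (mod m)}) / real N)
        \<longlonglongrightarrow> 1 / real_of_int m)"

end

theory Submission
  imports Defs
begin

text \<open>
Suppose that every nonconstant coefficient of \<open>P\<close> is rational, and let \<open>D\<close> be a
common denominator: \<open>D P(x) = Q(x) + D c\<close> with \<open>Q\<close> an integer polynomial and
\<open>c\<close> the constant term of \<open>P\<close>. Write \<open>a(k)\<close> for the floor of
\<open>P(k)\<close>. Replacing \<open>k\<close> by \<open>k + D m\<close> changes \<open>P(k)\<close> by an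
integer, so \<open>D a(k) = Q(k) - s(k)\<close> with \<open>s(k)\<close> depending only on \<open>k\<close>
modulo \<open>D\<close>, and \<open>a\<close> modulo a prime \<open>p\<close> not dividing \<open>D\<close> has
period \<open>D p\<close>. Uniform distribution modulo \<open>p\<close> therefore means that every residue
is taken exactly \<open>D\<close> times in one period (\<open>ud_mod_periodic_count\<close>). For every
integer polynomial \<open>g\<close>, summing \<open>g(D a(k))\<close> over a period shows
that \<open>\<Sum>r=1..D. \<Sum>x<p. g (Q x - s r)\<close> is congruent to
\<open>D * (\<Sum>y<p. g y)\<close> modulo \<open>p\<close>.

For \<open>p > D\<close> the shifts \<open>s(r)\<close> can be removed by induction on the degree of
\<open>g\<close> (\<open>sum_values_cong_of_shifted\<close>): the average of the shifted polynomials
\<open>g(X - s(r))\<close> has the same leading term as \<open>g\<close>. Hence the sum of \<open>g(Q(x))\<close>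
over all residues is congruent to the sum of \<open>g(y)\<close>, for every \<open>g\<close>, and choosing
\<open>g\<close> to single out one residue shows that \<open>Q\<close> is a permutation modulo
\<open>p\<close> (\<open>preimage_card_eq_1\<close>).

This cannot hold for all large primes when \<open>Q\<close> is nonlinear. Indeed
\<open>Q(X + 1) - Q(X)\<close> is then nonconstant, so by Schur's theorem
(\<open>int_poly_large_prime_divisor\<close>) its values have arbitrarily large prime divisors
\<open>p\<close>, and for such a \<open>p\<close> the polynomial \<open>Q\<close> takes the same value modulo
\<open>p\<close> at two consecutive integers.
\<close>

section \<open>Rational and integer polynomials\<close>

lemma common_denominator_poly:
  fixes P :: "real poly"
  assumes "\<And>i. poly.coeff P i \<in> \<rat>"
  shows "\<exists>(D::nat) (Q::int poly). D > 0 \<and> smult (real D) P = map_poly real_of_int Q"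
  using assms
proof (induction P)
  case 0
  show ?case by (rule exI[of _ 1], rule exI[of _ 0]) simp
next
  case (pCons a P)
  have "a \<in> \<rat>" using pCons.prems[of 0] by simp
  then obtain m n where a: "a = of_int m / of_nat n" and n: "n > 0"
    by (elim Rats_cases') (metis of_int_of_nat_eq zero_less_imp_eq_int of_nat_0_less_iff)
  have "poly.coeff P i \<in> \<rat>" for i using pCons.prems[of "Suc i"] by simp
  then obtain D Q where D: "D > 0" "smult (real D) P = map_poly real_of_int Q"
    using pCons.IH by blast
  have "smult (real (n * D)) (pCons a P)
      = pCons (real_of_int (int D * m)) (smult (real n) (smult (real D) P))"
    using n by (simp add: a)
  also have "\<dots> = map_poly real_of_int (pCons (int D * m) (smult (int n) Q))"
    by (subst map_poly_pCons) (auto simp: D(2) poly_eq_iff coeff_map_poly coeff_pCons split: nat.splits)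
  finally show ?case using n D(1) by (metis nat_0_less_mult_iff)
qed

lemma poly_map_of_int: "poly (map_poly real_of_int Q) (real_of_int x) = real_of_int (poly Q x)"
  by (induction Q) (auto simp: map_poly_pCons)

lemma poly_cong_int:
  fixes f :: "int poly"
  assumes "[x = y] (mod m)"
  shows "[poly f x = poly f y] (mod m)"
  using assms by (induction f) (auto intro: cong_add cong_mult)

lemma finite_poly_preimage:
  fixes f :: "int poly"
  assumes "degree f > 0"
  shows "finite {x. poly f x = c}"
proof -
  have "f - [:c:] \<noteq> 0" using assms by auto
  from poly_roots_finite[OF this] show ?thesis by simp
qed

text \<open>If \<open>Q(x + 1) - Q(x)\<close> were a constant, then \<open>Q\<close> would agree with a linear
polynomial at all natural numbers.\<close>

lemma degree_forward_difference_pos: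
  fixes Q :: "int poly"
  assumes "degree Q \<ge> 2"
  shows "degree (Q \<circ>\<^sub>p [:1, 1:] - Q) > 0"
proof (rule ccontr)
  assume "\<not> ?thesis"
  then obtain e where e: "Q \<circ>\<^sub>p [:1, 1:] - Q = [:e:]" by (metis degree_eq_zeroE gr0I)
  have step: "poly Q (x + 1) = poly Q x + e" for x
    using arg_cong[OF e, of "\<lambda>f. poly f x"] by (simp add: poly_pcompose algebra_simps)
  have "poly Q (int n) = poly Q 0 + int n * e" for n
  proof (induction n)
    case (Suc n)
    then show ?case using step[of "int n"] by (simp add: algebra_simps)
  qed simp
  then have "range int \<subseteq> {x. poly (Q - [:poly Q 0, e:]) x = 0}" by auto
  moreover have "infinite (range int)" by (simp add: range_inj_infinite)
  ultimately have "Q - [:poly Q 0, e:] = 0" using poly_roots_finite finite_subset by blast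
  then have "Q = [:poly Q 0, e:]" by simp
  moreover have "degree [:poly Q 0, e:] \<le> 1" by simp
  ultimately show False using assms by simp
qed

section \<open>Prime divisors of polynomial values\<close>

text \<open>Schur's theorem that the values of a nonconstant integer polynomial have infinitely many prime
divisors. With \<open>c = f(0)\<close> nonzero, \<open>f(c B! t) / c\<close> is an integer congruent to 1
modulo \<open>B!\<close>, so none of its prime factors is at most \<open>B\<close>; and it is not a unit
for all but finitely many \<open>t\<close>.\<close>

lemma int_poly_large_prime_divisor:
  fixes f :: "int poly"
  assumes "degree f > 0"
  shows "\<exists>p x. prime p \<and> int p > int B \<and> int p dvd poly f x"
proof (cases "poly f 0 = 0")
  case True
  obtain p where "prime p" "p > B" using bigger_prime by blast
  with True show ?thesis by (intro exI[of _ p] exI[of _ 0]) auto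
next
  case False
  define c where "c = poly f 0"
  define M :: int where "M = fact B"
  have c: "c \<noteq> 0" and M: "M \<noteq> 0" using False by (auto simp: c_def M_def)
  have "finite ({x. poly f x = c} \<union> {x. poly f x = -c})"
    using assms finite_poly_preimage by blast
  moreover have "infinite (range (\<lambda>t::int. c * M * t))"
    using c M by (subst finite_image_iff) (auto simp: inj_on_def infinite_UNIV_int)
  ultimately obtain t where t: "poly f (c * M * t) \<noteq> c" "poly f (c * M * t) \<noteq> -c"
    by (smt (verit) UnCI mem_Collect_eq rangeE finite_subset subsetI)
  define x where "x = c * M * t"
  have "[poly f x = c] (mod c * M)"
    unfolding c_def by (rule poly_cong_int) (simp add: x_def cong_def c_def)
  then obtain u where u: "poly f x = c * (1 + M * u)"
    by (metis (no_types, opaque_lifting) cong_iff_lin cong_sym mult.assoc distrib_left mult.right_neutral)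
  have "1 + M * u \<noteq> 1" "1 + M * u \<noteq> -1"
    using t u unfolding x_def by (metis mult.right_neutral, metis mult_minus1_right)
  then have "\<not> is_unit (1 + M * u)" by (simp add: zdvd1_eq abs_if split: if_splits)
  then obtain q :: int where q: "prime q" "q dvd 1 + M * u"
    using prime_divisor_exists[of "1 + M * u"]
    by (metis prime_divisor_exists dvd_0_right prime_factor_int zdvd1_eq)
  define p where "p = nat q"
  have p: "q = int p" "prime p"
    using q(1) prime_ge_0_int[OF q(1)] prime_int_nat_transfer[of q]
    unfolding p_def by (metis nat_0_le, blast)
  have "p > B"
  proof (rule ccontr)
    assume "\<not> p > B"
    then have "p dvd fact B" using p(2) by (simp add: prime_dvd_fact_iff)
    then have "q dvd M" unfolding M_def p(1) by (metis of_nat_dvd_iff of_nat_fact)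
    then have "q dvd 1" using q(2) by (metis dvd_add_left_iff dvd_mult2)
    then show False using q(1) by (simp add: not_prime_unit)
  qed
  then show ?thesis using p q(2) u by (intro exI[of _ p] exI[of _ x]) auto
qed

section \<open>Polynomial sums over residue classes\<close>

text \<open>The progression \<open>r, r + D, \<dots>, r + (p - 1) D\<close> is a complete residue system
modulo \<open>p\<close>.\<close>

lemma sum_arith_progression_cong:
  fixes F :: "int \<Rightarrow> int"
  assumes p: "p > 0" and cop: "coprime D p"
    and F: "\<And>x y. [x = y] (mod int p) \<Longrightarrow> [F x = F y] (mod int p)"
  shows "[(\<Sum>m<p. F (r + int D * int m)) = (\<Sum>x<p. F (int x))] (mod int p)"
proof -
  define \<phi> where "\<phi> m = nat ((r + int D * int m) mod int p)" for m
  have \<phi>: "int (\<phi> m) = (r + int D * int m) mod int p" for m using p by (simp add: \<phi>_def)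
  have inj: "inj_on \<phi> {..<p}"
  proof (rule inj_onI)
    fix x y assume xy: "x \<in> {..<p}" "y \<in> {..<p}" "\<phi> x = \<phi> y"
    then have "[r + int D * int x = r + int D * int y] (mod int p)"
      unfolding cong_def by (metis \<phi>)
    then have "[int x = int y] (mod int p)"
      using cop by (simp add: cong_add_lcancel cong_mult_lcancel)
    with xy show "x = y" by (simp add: cong_int_iff cong_less_modulus_unique_nat)
  qed
  moreover have "\<phi> ` {..<p} \<subseteq> {..<p}" using p by (auto simp: \<phi>_def nat_less_iff)
  ultimately have "bij_betw \<phi> {..<p} {..<p}"
    by (simp add: bij_betw_def endo_inj_surj)
  then have "(\<Sum>x<p. F (int x)) = (\<Sum>m<p. F (int (\<phi> m)))"
    by (rule sum.reindex_bij_betw[symmetric])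
  moreover have "[(\<Sum>m<p. F (int (\<phi> m))) = (\<Sum>m<p. F (r + int D * int m))] (mod int p)"
    by (intro cong_sum F) (simp add: \<phi> cong_def)
  ultimately show ?thesis by (simp add: cong_sym)
qed

text \<open>Every shift of \<open>g\<close> has the same leading coefficient as \<open>g\<close>, so the leading
terms cancel. This makes the induction on the degree in \<open>sum_values_cong_of_shifted\<close> possible.\<close>

lemma degree_sum_of_shifts_less:
  fixes g :: "int poly" and R :: "'a set"
  assumes "degree g > 0" "finite R"
  shows "degree ((\<Sum>r\<in>R. g \<circ>\<^sub>p [:- s r, 1:]) - smult (int (card R)) g) < degree g" (is "degree ?h < _")
proof (cases "?h = 0")
  case False
  show ?thesis
  proof (rule degree_less_if_less_eqI)
    show "degree ?h \<le> degree g"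
      using assms(2) by (intro degree_diff_le degree_sum_le) (auto simp: degree_pcompose)
    have "poly.coeff (g \<circ>\<^sub>p [:- s r, 1:]) (degree g) = lead_coeff g" for r
      using lead_coeff_comp[of "[:- s r, 1:]" g] by (simp add: degree_pcompose)
    then show "poly.coeff ?h (degree g) = 0" by (simp add: coeff_sum)
  qed (use False in auto)
qed (use assms in auto)

text \<open>The hypothesis says that \<open>Q\<close> permutes the residues modulo \<open>p\<close> on average over
the shifts \<open>s r\<close>, as far as sums modulo \<open>p\<close> of polynomials can see; the
conclusion removes the shifts. The defect \<open>L g\<close>, the difference of the two sums in the
conclusion, is linear in \<open>g\<close>, and the hypothesis says that \<open>L\<close> vanishes modulo
\<open>p\<close> on the sum of the shifts of \<open>g\<close>. Up to terms of smaller degree that sum is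
\<open>card R\<close> times \<open>g\<close>, and \<open>card R\<close> is invertible modulo \<open>p\<close>.\<close>

lemma sum_values_cong_of_shifted:
  fixes Q :: "int \<Rightarrow> int" and s :: "'a \<Rightarrow> int"
  assumes p: "prime p" and R: "finite R" "coprime (card R) p"
    and shifted: "\<And>g :: int poly. [(\<Sum>r\<in>R. \<Sum>x<p. poly g (Q (int x) - s r))
       = int (card R) * (\<Sum>y<p. poly g (int y))] (mod int p)"
  shows "[(\<Sum>x<p. poly g (Q (int x))) = (\<Sum>y<p. poly g (int y))] (mod int p)"
proof -
  define L where "L g = (\<Sum>x<p. poly g (Q (int x))) - (\<Sum>y<p. poly g (int y))" for g
  have L_diff: "L (g - h) = L g - L h" for g h
    by (simp add: L_def sum_subtractf)
  have L_smult: "L (smult c g) = c * L g" for c g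
    by (simp add: L_def sum_distrib_left right_diff_distrib)
  have L_sum: "L (\<Sum>r\<in>R. h r) = (\<Sum>r\<in>R. L (h r))" for h
    unfolding L_def poly_sum sum_subtractf by (simp add: sum.swap[of _ R])
  have L_shifts: "int p dvd L (\<Sum>r\<in>R. g \<circ>\<^sub>p [:- s r, 1:])" for g
  proof -
    have "[(\<Sum>y<p. poly g (int y - s r)) = (\<Sum>y<p. poly g (int y))] (mod int p)" for r
      using sum_arith_progression_cong[of p 1 "poly g" "- s r"] poly_cong_int[of _ _ "int p" g]
        prime_gt_0_nat[OF p] by simp
    then have "[(\<Sum>r\<in>R. \<Sum>y<p. poly g (int y - s r)) = (\<Sum>r\<in>R. \<Sum>y<p. poly g (int y))] (mod int p)"
      by (rule cong_sum)
    with shifted[of g] have "[(\<Sum>r\<in>R. \<Sum>x<p. poly g (Q (int x) - s r))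
        = (\<Sum>r\<in>R. \<Sum>y<p. poly g (int y - s r))] (mod int p)"
      by (simp add: cong_def)
    then show ?thesis
      unfolding L_sum by (simp add: L_def poly_pcompose sum_subtractf cong_iff_dvd_diff)
  qed
  have "int p dvd L g"
  proof (induction "degree g" arbitrary: g rule: less_induct)
    case less
    show ?case
    proof (cases "degree g = 0")
      case True
      then obtain c where "g = [:c:]" by (rule degree_eq_zeroE)
      then show ?thesis by (simp add: L_def)
    next
      case False
      then have "int p dvd L ((\<Sum>r\<in>R. g \<circ>\<^sub>p [:- s r, 1:]) - smult (int (card R)) g)"
        using less degree_sum_of_shifts_less[of g R s] R(1) by simp
      then have "int p dvd int (card R) * L g"
        using L_shifts[of g] by (simp add: L_diff L_smult dvd_diff_right_iff)
      moreover have "coprime (int p) (int (card R))" using R(2) by (simp add: coprime_commute)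
      ultimately show ?thesis by (simp add: coprime_dvd_mult_right_iff)
    qed
  qed
  then show ?thesis by (simp add: L_def cong_iff_dvd_diff)
qed

text \<open>An integer polynomial \<open>g\<close> that is a unit modulo \<open>p\<close> at the residue of
\<open>a\<close> and vanishes modulo \<open>p\<close> at all other residues counts preimages of
\<open>a\<close>. The hypothesis then says that their number is congruent to 1, and it is at
most \<open>p\<close>.\<close>

lemma preimage_card_eq_1:
  fixes Q :: "int \<Rightarrow> int"
  assumes p: "prime p"
    and moments: "\<And>g :: int poly.
       [(\<Sum>x<p. poly g (Q (int x))) = (\<Sum>y<p. poly g (int y))] (mod int p)"
  shows "card {x \<in> {..<p}. [Q (int x) = a] (mod int p)} = 1"
proof -
  have p1: "p > 1" using p by (rule prime_gt_1_nat)
  \<comment> \<open>The roots of \<open>g\<close> represent all residues except that of \<open>a\<close>, and \<open>w\<close> is its value at \<open>a\<close>.\<close>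
  define g where "g = (\<Prod>b\<in>{1..<p}. [:- a - int b, 1:])"
  define w where "w = (\<Prod>b\<in>{1..<p}. - int b)"
  have g: "poly g y = (\<Prod>b\<in>{1..<p}. y - a - int b)" for y
    unfolding g_def poly_prod by (simp add: algebra_simps)
  have g_eq: "[poly g y = (if [y = a] (mod int p) then w else 0)] (mod int p)" for y
  proof (cases "[y = a] (mod int p)")
    case True
    then have "[y - a - int b = - int b] (mod int p)" for b
      using cong_diff[OF True cong_refl[of "a + int b"]] by (simp add: algebra_simps)
    then show ?thesis using True by (auto simp: g w_def intro!: cong_prod)
  next
    case False
    define b where "b = nat ((y - a) mod int p)"
    have b: "int b = (y - a) mod int p" using p1 by (simp add: b_def)
    \<comment> \<open>The factor of \<open>poly g y\<close> with this index is divisible by \<open>p\<close>.\<close>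
    have "b \<noteq> 0"
      using False b by (metis cong_iff_dvd_diff dvd_eq_mod_eq_0 of_nat_0)
    moreover have "b < p" using p1 by (simp add: b_def nat_less_iff)
    ultimately have "b \<in> {1..<p}" by auto
    moreover have "int p dvd y - a - int b" by (simp add: b dvd_minus_mod)
    ultimately have "int p dvd poly g y" unfolding g by (meson dvd_prodI dvd_trans finite_atLeastLessThan)
    then show ?thesis using False by (simp add: cong_0_iff)
  qed
  have count: "[(\<Sum>x<p. poly g (f x)) = int (card {x \<in> {..<p}. [f x = a] (mod int p)}) * w] (mod int p)"
    for f :: "nat \<Rightarrow> int"
  proof -
    have "[(\<Sum>x<p. poly g (f x)) = (\<Sum>x<p. if [f x = a] (mod int p) then w else 0)] (mod int p)"
      by (intro cong_sum g_eq)
    then show ?thesis by (simp add: sum.If_cases Int_def)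
  qed
  let ?N = "card {x \<in> {..<p}. [Q (int x) = a] (mod int p)}"
  have "coprime w (int p)"
    unfolding w_def
  proof (rule prod_coprime_left)
    fix b assume "b \<in> {1..<p}"
    then have "\<not> p dvd b" by (auto dest: dvd_imp_le)
    then show "coprime (- int b) (int p)" using prime_imp_coprime[OF p] by (simp add: coprime_commute)
  qed
  moreover have "{x \<in> {..<p}. [int x = a] (mod int p)} = {nat (a mod int p)}"
    using p1 by (auto simp: cong_def nat_less_iff zmod_int)
  then have "[int ?N * w = 1 * w] (mod int p)"
    using cong_trans[OF cong_sym[OF count[of "\<lambda>x. Q (int x)"]] cong_trans[OF moments count[of int]]] by simp
  ultimately have "[int ?N = 1] (mod int p)" using cong_mult_rcancel by blast
  then have cong: "[?N = 1] (mod p)" using cong_int_iff[of ?N 1 p] by simp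
  have "?N \<le> card {..<p}" by (intro card_mono) auto
  then have "?N < p \<or> ?N = p" by auto
  with cong p1 show ?thesis by (auto simp: cong_def)
qed

section \<open>Uniform distribution of periodic sequences\<close>

text \<open>For a sequence of period \<open>T\<close> the limiting frequency of a residue is its exact frequency
in one period, as one sees along the multiples of \<open>T\<close>.\<close>

lemma ud_mod_periodic_count:
  assumes ud: "ud_mod a m" and T: "T > 0"
    and per: "\<And>k. [a (k + T) = a k] (mod m)"
  shows "real (card {k \<in> {1..T}. [a k = i] (mod m)}) = real T / real_of_int m"
proof -
  define A where "A N = {k \<in> {1..N}. [a k = i] (mod m)}" for N
  have per': "[a (k + n * T) = a k] (mod m)" for k n
  proof (induction n)
    case (Suc n)
    have "[a (k + n * T + T) = a k] (mod m)" using cong_trans[OF per Suc] .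
    then show ?case by (simp add: algebra_simps)
  qed simp
  have card_A: "card (A (n * T)) = n * card (A T)" for n
  proof (induction n)
    case (Suc n)
    have "A (Suc n * T) = A (n * T) \<union> (\<lambda>k. k + n * T) ` A T"
    proof (intro equalityI subsetI)
      fix k assume k: "k \<in> A (Suc n * T)"
      show "k \<in> A (n * T) \<union> (\<lambda>k. k + n * T) ` A T"
      proof (cases "k \<le> n * T")
        case False
        then have "k - n * T \<in> A T"
          using k per'[of "k - n * T" n] by (auto simp: A_def intro: cong_trans cong_sym)
        moreover have "k = (k - n * T) + n * T" using False by simp
        ultimately show ?thesis by blast
      qed (use k in \<open>auto simp: A_def\<close>)
    next
      fix k assume "k \<in> A (n * T) \<union> (\<lambda>k. k + n * T) ` A T"
      then show "k \<in> A (Suc n * T)" using per' by (auto simp: A_def intro: cong_trans)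
    qed
    moreover have "A (n * T) \<inter> (\<lambda>k. k + n * T) ` A T = {}" by (auto simp: A_def)
    moreover have "card ((\<lambda>k. k + n * T) ` A T) = card (A T)"
      by (intro card_image) (simp add: inj_on_def)
    moreover have "finite (A N)" for N by (simp add: A_def)
    ultimately show ?case using Suc by (simp add: card_Un_disjoint)
  qed (simp add: A_def)
  have "(\<lambda>N. real (card (A N)) / real N) \<longlonglongrightarrow> 1 / real_of_int m"
    using ud unfolding ud_mod_def A_def by blast
  moreover have "filterlim (\<lambda>n. n * T) sequentially sequentially"
    using T by (simp add: mult_nat_right_at_top)
  ultimately have "(\<lambda>n. real (card (A (n * T))) / real (n * T)) \<longlonglongrightarrow> 1 / real_of_int m"
    by (rule filterlim_compose)
  moreover have "\<forall>\<^sub>F n in sequentially. real (card (A (n * T))) / real (n * T) = real (card (A T)) / real T"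
    using eventually_gt_at_top[of 0] by eventually_elim (simp add: card_A)
  ultimately have "(\<lambda>n::nat. real (card (A T)) / real T) \<longlonglongrightarrow> 1 / real_of_int m"
    using tendsto_cong by fast
  then have "real (card (A T)) / real T = 1 / real_of_int m"
    using LIMSEQ_unique tendsto_const by blast
  then show ?thesis using T by (simp add: A_def field_simps)
qed

lemma sum_cong_of_equal_counts:
  fixes a :: "'a \<Rightarrow> int" and F :: "int \<Rightarrow> int"
  assumes p: "p > 0" and fin: "finite K"
    and count: "\<And>i. card {k \<in> K. [a k = i] (mod int p)} = D"
    and F: "\<And>x y. [x = y] (mod int p) \<Longrightarrow> [F x = F y] (mod int p)"
  shows "[(\<Sum>k\<in>K. F (a k)) = int D * (\<Sum>y<p. F (int y))] (mod int p)"
proof -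
  define b where "b k = nat (a k mod int p)" for k
  have b: "int (b k) = a k mod int p" for k using p by (simp add: b_def)
  have fibre: "{k \<in> K. b k = y} = {k \<in> K. [a k = int y] (mod int p)}" if "y < p" for y
    using that by (auto simp: cong_def b_def nat_eq_iff)
  have "(\<Sum>k\<in>K. F (int (b k))) = (\<Sum>y<p. \<Sum>k | k \<in> K \<and> b k = y. F (int (b k)))"
    using p fin by (intro sum.group[symmetric]) (auto simp: b_def nat_less_iff)
  also have "\<dots> = (\<Sum>y<p. int D * F (int y))"
  proof (rule sum.cong)
    fix y assume "y \<in> {..<p}"
    then have "card {k \<in> K. b k = y} = D" using fibre count by simp
    moreover have "(\<Sum>k | k \<in> K \<and> b k = y. F (int (b k))) = (\<Sum>k | k \<in> K \<and> b k = y. F (int y))"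
      by (intro sum.cong) auto
    ultimately show "(\<Sum>k | k \<in> K \<and> b k = y. F (int (b k))) = int D * F (int y)" by simp
  qed simp
  finally have "(\<Sum>k\<in>K. F (int (b k))) = int D * (\<Sum>y<p. F (int y))"
    by (simp add: sum_distrib_left)
  moreover have "[(\<Sum>k\<in>K. F (a k)) = (\<Sum>k\<in>K. F (int (b k)))] (mod int p)"
    by (intro cong_sum F) (simp add: b cong_def)
  ultimately show ?thesis by simp
qed

lemma sum_over_blocks:
  fixes f :: "nat \<Rightarrow> 'a :: comm_monoid_add"
  shows "(\<Sum>k\<in>{1..D * n}. f k) = (\<Sum>r\<in>{1..D}. \<Sum>m<n. f (r + D * m))"
proof (induction n)
  case (Suc n)
  have "(\<Sum>k\<in>{1..D * Suc n}. f k) = (\<Sum>k\<in>{1..D * n}. f k) + (\<Sum>k\<in>{1 + D * n..D + D * n}. f k)"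
    using sum.ub_add_nat[of 1 "D * n" f D] by (simp add: add.commute)
  also have "(\<Sum>k\<in>{1 + D * n..D + D * n}. f k) = (\<Sum>r\<in>{1..D}. f (r + D * n))"
    by (rule sum.shift_bounds_cl_nat_ivl)
  finally show ?case unfolding Suc by (simp add: sum.distrib)
qed simp

section \<open>Nonlinear polynomials with rational nonconstant coefficients\<close>

theorem theorem11:
  fixes P :: "real poly"
  assumes "degree P \<ge> 2"
    and "\<exists>p\<^sub>0::int. \<forall>p::int. prime p \<and> p \<ge> p\<^sub>0 \<longrightarrow> ud_mod (\<lambda>k. \<lfloor>poly P (real k)\<rfloor>) p"
  shows "\<exists>i\<ge>1. poly.coeff P i \<notin> \<rat>"
proof (rule ccontr)
  assume "\<not> ?thesis"
  then have "poly.coeff (P - [:poly.coeff P 0:]) i \<in> \<rat>" for i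
    by (cases i) auto
  then obtain D Q where D: "D > 0"
    and Q: "smult (real D) (P - [:poly.coeff P 0:]) = map_poly real_of_int Q"
    using common_denominator_poly by blast
  have "degree (P - [:poly.coeff P 0:]) = degree P"
    using assms(1) by (metis add_uminus_conv_diff degree_add_eq_left degree_minus degree_pCons_0 less_le_trans pos2)
  then have "degree Q \<ge> 2"
    using assms(1) D arg_cong[OF Q, of degree] by (simp add: degree_map_poly)
  define a where "a k = \<lfloor>poly P (real k)\<rfloor>" for k
  have PQ: "real D * (poly P (real k) - poly.coeff P 0) = real_of_int (poly Q (int k))" for k
    using arg_cong[OF Q, of "\<lambda>f. poly f (real_of_int (int k))"] unfolding poly_map_of_int by simp
  have a_step: "int D * (a (k + D * m) - a k) = poly Q (int (k + D * m)) - poly Q (int k)" for k m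
  proof -
    have "[poly Q (int (k + D * m)) = poly Q (int k)] (mod int D)"
      by (rule poly_cong_int) (simp add: cong_def)
    then obtain t where t: "poly Q (int (k + D * m)) - poly Q (int k) = int D * t"
      unfolding cong_iff_dvd_diff by blast
    have "real D * (poly P (real (k + D * m)) - poly P (real k)) = real D * real_of_int t"
      using arg_cong[OF t, of real_of_int] PQ[of k] PQ[of "k + D * m"]
      by (simp only: of_int_diff of_int_mult of_int_of_nat_eq right_diff_distrib)
    then have "poly P (real (k + D * m)) = poly P (real k) + real_of_int t" using D by simp
    then have "a (k + D * m) = a k + t" unfolding a_def by (simp only: floor_add_int)
    then show ?thesis using t by simp
  qed
  obtain p0 :: int where p0: "\<And>p. prime p \<Longrightarrow> p \<ge> p0 \<Longrightarrow> ud_mod a p"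
    using assms(2) unfolding a_def by blast
  \<comment> \<open>Large enough for uniform distribution and for \<open>D\<close> to be invertible modulo \<open>p\<close>.\<close>
  obtain p x where p: "prime p" "int p > int (D + nat p0)" and "int p dvd poly (Q \<circ>\<^sub>p [:1, 1:] - Q) x"
    using int_poly_large_prime_divisor degree_forward_difference_pos[OF \<open>degree Q \<ge> 2\<close>] by blast
  then have coll: "[poly Q (x + 1) = poly Q x] (mod int p)"
    by (simp add: cong_iff_dvd_diff poly_pcompose algebra_simps)
  have pD: "p > D" "p > 1" using p(2) prime_gt_1_nat[OF p(1)] by linarith+
  then have cop: "coprime D p"
    using D prime_imp_coprime[OF p(1), of D] dvd_imp_le[of p D] by (auto simp: coprime_commute)
  \<comment> \<open>Taking \<open>m = p\<close> in \<open>a_step\<close>, and cancelling \<open>D\<close>, gives the period \<open>D p\<close>.\<close>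
  have per: "[a (k + D * p) = a k] (mod int p)" for k
  proof -
    have "[poly Q (int (k + D * p)) = poly Q (int k)] (mod int p)"
      by (rule poly_cong_int) (simp add: cong_def)
    then have "int p dvd int D * (a (k + D * p) - a k)" by (simp add: a_step cong_iff_dvd_diff)
    moreover have "coprime (int p) (int D)" using cop by (simp add: coprime_commute)
    ultimately show ?thesis by (simp add: coprime_dvd_mult_right_iff cong_iff_dvd_diff)
  qed
  have "ud_mod a (int p)" using p p0[of "int p"] by (auto split: if_splits)
  then have count: "card {k \<in> {1..D * p}. [a k = i] (mod int p)} = D" for i
    using ud_mod_periodic_count[of a "int p" "D * p" i] per D pD by simp
  \<comment> \<open>By \<open>a_step\<close>, \<open>D a(k) = Q(k) - s(k)\<close> where \<open>s(k)\<close> depends only on \<open>k\<close> modulo \<open>D\<close>.\<close>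
  define s where "s r = poly Q (int r) - int D * a r" for r
  have shifted: "[(\<Sum>r\<in>{1..D}. \<Sum>x<p. poly g (poly Q (int x) - s r))
      = int (card {1..D}) * (\<Sum>y<p. poly g (int y))] (mod int p)" for g :: "int poly"
  proof -
    \<comment> \<open>The factor \<open>D\<close> clears the denominator of \<open>a\<close>; it disappears again on the right, where multiplication by \<open>D\<close> permutes the residues modulo \<open>p\<close>.\<close>
    define F where "F y = poly g (int D * y)" for y
    have F: "[F x = F y] (mod int p)" if "[x = y] (mod int p)" for x y
      unfolding F_def using that by (intro poly_cong_int cong_mult) auto
    have "int D * a (r + D * m) = poly Q (int r + int D * int m) - s r" for r m
      using a_step[of r m] by (simp add: s_def algebra_simps)
    then have "F (a (r + D * m)) = poly g (poly Q (int r + int D * int m) - s r)" for r m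
      unfolding F_def by (rule arg_cong)
    then have "(\<Sum>k\<in>{1..D * p}. F (a k))
        = (\<Sum>r\<in>{1..D}. \<Sum>m<p. poly g (poly Q (int r + int D * int m) - s r))"
      unfolding sum_over_blocks by simp
    also have "[\<dots> = (\<Sum>r\<in>{1..D}. \<Sum>x<p. poly g (poly Q (int x) - s r))] (mod int p)"
      using pD cop by (intro cong_sum sum_arith_progression_cong) (auto intro!: poly_cong_int cong_diff)
    finally have "[(\<Sum>k\<in>{1..D * p}. F (a k))
        = (\<Sum>r\<in>{1..D}. \<Sum>x<p. poly g (poly Q (int x) - s r))] (mod int p)" .
    moreover have "[(\<Sum>k\<in>{1..D * p}. F (a k)) = int D * (\<Sum>y<p. F (int y))] (mod int p)"
      using pD count F by (intro sum_cong_of_equal_counts) auto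
    moreover have "[(\<Sum>y<p. F (int y)) = (\<Sum>y<p. poly g (int y))] (mod int p)"
      using sum_arith_progression_cong[of p D "poly g" 0] pD cop poly_cong_int[of _ _ "int p" g]
      by (simp add: F_def)
    then have "[int D * (\<Sum>y<p. F (int y)) = int D * (\<Sum>y<p. poly g (int y))] (mod int p)"
      by (rule cong_scalar_left)
    ultimately show ?thesis by (simp add: cong_def)
  qed
  have moments: "[(\<Sum>x<p. poly g (poly Q (int x))) = (\<Sum>y<p. poly g (int y))] (mod int p)" for g
    using p(1) cop shifted by (intro sum_values_cong_of_shifted[where R = "{1..D}" and s = s]) auto
  \<comment> \<open>So \<open>Q\<close> is injective modulo \<open>p\<close>, against the collision of \<open>x\<close> and \<open>x + 1\<close>.\<close>
  define A where "A = {z \<in> {..<p}. [poly Q (int z) = poly Q x] (mod int p)}"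
  have card_A: "card A = 1"
    unfolding A_def using p(1) moments by (rule preimage_card_eq_1)
  have in_A: "nat (z mod int p) \<in> A" if "[poly Q z = poly Q x] (mod int p)" for z
  proof -
    have "[poly Q (z mod int p) = poly Q z] (mod int p)" by (rule poly_cong_int) (simp add: cong_def)
    then show ?thesis using that pD by (auto simp: A_def nat_less_iff intro: cong_trans)
  qed
  have "nat ((x + 1) mod int p) = nat (x mod int p)"
    using in_A[OF coll] in_A[of x] card_A by (auto simp: card_1_singleton_iff)
  then have "[x + 1 = x] (mod int p)" using pD by (simp add: cong_def eq_nat_nat_iff)
  then show False using pD by (simp add: cong_iff_dvd_diff)
qed

end
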